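(* Let $G$ be a precompact Hausdorff abelian topological group and let $A$ be a topologically independent subset of $G$. Then $A$ is absolutely Cauchy summable.
   Context: All groups are abelian (written additively) and all topological groups are Hausdorff. A topological group is precompact if it is a topological subgroup of a compact group. For a subset $X$ of a group $G$, $\langle X\rangle$ denotes the subgroup of $G$ generated by $X$. A set $A$ of nonzero elements of a topological group $G$ is topologically independent if for every neighborhood $W$ of $0_G$ there exists a neighborhood $U$ of $0_G$ such that for every finite set $B\subset A$ and every family $(z_a)_{a\in B}$ of integers, $\sum_{a\in B}z_a a\in U$ implies $z_a a\in W$ for all $a\in B$. (In particular, a topologically independent set consists of nonzero elements.) A subset $A$ of a topological group $G$ is absolutely Cauchy summable if for every neighborhood $U$ of $0_G$ there exists a finite set $F\subset A$ such that $\langle A\setminus F\rangle\subset U$. *)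

theory Defs
  imports "HOL-Analysis.Analysis" "HOL-Computational_Algebra.Group_Closure"
begin

text \<open>
  The group \<open>G\<close> is the whole type \<open>'g\<close>. Precompactness is witnessed by a topological group
  embedding of \<open>'g\<close> into a compact Hausdorff group, which is the whole of a second type \<open>'k\<close>.
  Types cannot be quantified existentially, so \<open>'k\<close> is a parameter of the definition. If
  \<open>'k\<close> occurs only in a hypothesis of a theorem and is left free, the implicit universal
  quantification over it outside the implication amounts to an existential one in that hypothesis.
\<close>

definition precompact_group ::
  "'g::{topological_ab_group_add, t2_space} itself \<Rightarrow>
   'k::{topological_ab_group_add, t2_space} itself \<Rightarrow> bool"
  where
  "precompact_group TYPE('g) TYPE('k) \<longleftrightarrow>
     compact (UNIV :: 'k set) \<and>
     (\<exists>h :: 'g \<Rightarrow> 'k. Modules.additive h \<and> embedding_map euclidean euclidean h)"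

definition int_scale :: "int \<Rightarrow> 'g::ab_group_add \<Rightarrow> 'g"
  where
  "int_scale z a =
     (if 0 \<le> z then (\<Sum>i<nat z. a) else - (\<Sum>i<nat (- z). a))"

text \<open>Neighborhoods of \<open>0\<close> are not required to be open: \<open>W\<close> is one iff \<open>0 \<in> interior W\<close>.\<close>

definition topologically_independent :: "'g::{topological_ab_group_add, t2_space} set \<Rightarrow> bool"
  where
  "topologically_independent A \<longleftrightarrow>
     0 \<notin> A \<and>
     (\<forall>W. 0 \<in> interior W \<longrightarrow>
        (\<exists>U. 0 \<in> interior U \<and>
           (\<forall>B (z :: 'g \<Rightarrow> int). finite B \<and> B \<subseteq> A \<and> (\<Sum>a\<in>B. int_scale (z a) a) \<in> U \<longrightarrow>
              (\<forall>a\<in>B. int_scale (z a) a \<in> W))))"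

text \<open>\<^const>\<open>group_closure\<close> is the generated subgroup, with no topological closure involved.\<close>

definition absolutely_cauchy_summable :: "'g::{topological_ab_group_add, t2_space} set \<Rightarrow> bool"
  where
  "absolutely_cauchy_summable A \<longleftrightarrow>
     (\<forall>U. 0 \<in> interior U \<longrightarrow>
        (\<exists>F. finite F \<and> F \<subseteq> A \<and> group_closure (A - F) \<subseteq> U))"

end

theory Submission
  imports Defs "HOL-Library.Function_Algebras"
begin

text \<open>
  Covering the group by finitely many translates of a neighborhood and applying the pigeonhole
  principle to the partial sums of \<open>\<Sum>i. k\<^sub>i a\<^sub>i\<close> shows that for every neighborhood \<open>W\<close> all but finitely
  many elements of \<open>A\<close> generate a cyclic subgroup inside \<open>W\<close>. It remains to see that in a
  precompact group finitely many cyclic subgroups inside a small \<open>W\<close> generate a subgroup inside a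
  given \<open>U\<close>.

  Characters would give this at once. Instead of the Peter--Weyl theorem, the proof uses
  Fourier analysis without characters on \<open>(\<int>/N)\<^sup>B\<close>, which maps to the group by
  \<open>\<sigma>(y) = \<Sum>b\<in>B. (y b mod N) b\<close>; \<open>N\<close> is chosen so that all \<open>N b\<close> are tiny and \<open>\<sigma>\<close> is nearly additive.
  Let \<open>F\<close> be the pullback along \<open>\<sigma>\<close> of a bump function with small support and mean
  \<open>c \<ge> 1/m\<close>, where \<open>m\<close> depends on \<open>U\<close> only. As the cyclic subgroups lie in \<open>W\<close>, \<open>F\<close> varies by at most
  \<open>\<epsilon>\<close> along each coordinate axis, so all its nontrivial Fourier coefficients are at most \<open>\<epsilon>\<close> and the
  autocorrelation \<open>K\<close> of \<open>F\<close> satisfies \<open>mean K\<^sup>2 \<le> c\<^sup>4 + \<epsilon>\<^sup>2\<close>. If a combination \<open>\<Sum>b\<in>B. z\<^sub>b b\<close> were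
  outside \<open>U\<close>, then \<open>K(x) K(x + z) = 0\<close> for all \<open>x\<close>, and since \<open>mean K = c\<^sup>2\<close> this forces
  \<open>mean K\<^sup>2 \<ge> 2 c\<^sup>4\<close>, which is impossible for small \<open>\<epsilon>\<close>.
\<close>

section \<open>Integer multiples and generated subgroups\<close>

lemma int_scale_0 [simp]: "int_scale 0 a = 0"
  by (simp add: int_scale_def)

lemma int_scale_add1: "int_scale (z + 1) a = int_scale z a + a"
proof (cases "0 \<le> z")
  case True
  then have "nat (z + 1) = Suc (nat z)" by simp
  with True show ?thesis by (simp add: int_scale_def)
next
  case False
  then have "nat (- z) = Suc (nat (- (z + 1)))" by simp
  with False have "int_scale z a = - ((\<Sum>i<nat (- (z + 1)). a) + a)"
    by (simp add: int_scale_def add.commute)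
  moreover have "int_scale (z + 1) a = - (\<Sum>i<nat (- (z + 1)). a)"
    using False by (cases "z = -1") (auto simp: int_scale_def)
  ultimately show ?thesis by simp
qed

lemma int_scale_Suc: "int_scale (int (Suc k)) a = int_scale (int k) a + a"
  using int_scale_add1[of "int k" a] by (simp only: of_nat_Suc add.commute)

lemma int_scale_diff1: "int_scale (z - 1) a = int_scale z a - a"
  using int_scale_add1[of "z - 1" a] by simp

lemma int_scale_1 [simp]: "int_scale 1 a = a"
  using int_scale_add1[of 0 a] by simp

lemma int_scale_add: "int_scale (x + y) a = int_scale x a + int_scale y a"
proof (induction y rule: int_induct[where k = 0])
  case (step1 i)
  then show ?case using int_scale_add1[of "x + i" a] int_scale_add1[of i a]
    by (simp add: algebra_simps)
next
  case (step2 i)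
  have "x + (i - 1) = x + i - 1" by simp
  with step2 show ?case by (simp only: int_scale_diff1 add_diff_eq)
qed simp

lemma int_scale_minus: "int_scale (- x) a = - int_scale x a"
  using int_scale_add[of x "- x" a] by (simp add: eq_neg_iff_add_eq_0 add.commute)

lemma int_scale_diff: "int_scale (x - y) a = int_scale x a - int_scale y a"
  using int_scale_add[of x "- y" a] by (simp add: int_scale_minus)

lemma int_scale_mult: "int_scale (x * y) a = int_scale x (int_scale y a)"
proof (induction x rule: int_induct[where k = 0])
  case (step1 i)
  then show ?case by (simp add: distrib_right int_scale_add)
next
  case (step2 i)
  then show ?case by (simp add: left_diff_distrib int_scale_diff)
qed simp

text \<open>Together with \<open>int_scale_fun\<close> this evaluates multiples of axis vectors in
  \<open>'b \<Rightarrow> int\<close>.\<close>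

lemma int_scale_int [simp]: "int_scale z (c :: int) = z * c"
proof (induction z rule: int_induct[where k = 0])
  case (step1 i)
  then show ?case by (simp add: distrib_right int_scale_add)
next
  case (step2 i)
  then show ?case by (simp add: left_diff_distrib int_scale_diff)
qed simp

lemma int_scale_fun: "int_scale z f x = int_scale z (f x)"
proof (induction z rule: int_induct[where k = 0])
  case (step1 i)
  then show ?case by (simp add: int_scale_add)
next
  case (step2 i)
  then show ?case by (simp add: int_scale_diff)
qed simp

lemma group_closure_int_combination:
  assumes "x \<in> group_closure S"
  obtains B z where "finite B" "B \<subseteq> S" "x = (\<Sum>b\<in>B. int_scale (z b) b)"
proof -
  have "\<exists>B z. finite B \<and> B \<subseteq> S \<and> x = (\<Sum>b\<in>B. int_scale (z b) b)"
    using assms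
  proof (induction rule: group_closure.induct)
    case (base s)
    show ?case
    proof (cases "s = 0")
      case True
      then show ?thesis by (intro exI[of _ "{}"]) simp
    next
      case False
      with base show ?thesis by (intro exI[of _ "{s}"] exI[of _ "\<lambda>_. 1"]) auto
    qed
  next
    case (diff s t)
    then obtain B z where B: "finite B" "B \<subseteq> S" "s = (\<Sum>b\<in>B. int_scale (z b) b)" by blast
    from diff obtain C y where C: "finite C" "C \<subseteq> S" "t = (\<Sum>b\<in>C. int_scale (y b) b)" by blast
    \<comment> \<open>Coefficients are extended by 0 so that both sums run over the union.\<close>
    define z' where "z' b = (if b \<in> B then z b else 0)" for b
    define y' where "y' b = (if b \<in> C then y b else 0)" for b
    have "s = (\<Sum>b\<in>B \<union> C. int_scale (z' b) b)"
      unfolding B(3) by (rule sum.mono_neutral_cong_left) (use B C in \<open>auto simp: z'_def\<close>)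
    moreover have "t = (\<Sum>b\<in>B \<union> C. int_scale (y' b) b)"
      unfolding C(3) by (rule sum.mono_neutral_cong_left) (use B C in \<open>auto simp: y'_def\<close>)
    ultimately have "s - t = (\<Sum>b\<in>B \<union> C. int_scale (z' b - y' b) b)"
      by (simp add: sum_subtractf int_scale_diff)
    then show ?case using B C by (intro exI[of _ "B \<union> C"] exI[of _ "\<lambda>b. z' b - y' b"]) auto
  qed
  then show ?thesis using that by blast
qed

section \<open>Neighborhoods of zero and total boundedness\<close>

lemma open_zero_halve:
  fixes U :: "'g::topological_ab_group_add set"
  assumes "open U" "0 \<in> U"
  obtains V where "open V" "0 \<in> V" "\<And>x y. x \<in> V \<Longrightarrow> y \<in> V \<Longrightarrow> x + y \<in> U"
proof -
  have "continuous_on UNIV (\<lambda>p :: 'g \<times> 'g. fst p + snd p)"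
    by (intro continuous_intros)
  then have "open ((\<lambda>p :: 'g \<times> 'g. fst p + snd p) -` U)"
    using assms(1) by (simp add: open_vimage)
  moreover have "(0, 0) \<in> (\<lambda>p :: 'g \<times> 'g. fst p + snd p) -` U" using assms by simp
  ultimately obtain A B where AB: "open A" "open B" "(0, 0) \<in> A \<times> B"
      "A \<times> B \<subseteq> (\<lambda>p :: 'g \<times> 'g. fst p + snd p) -` U"
    by (rule open_prod_elim)
  show ?thesis by (rule that[of "A \<inter> B"]) (use AB in auto)
qed

text \<open>Induction on \<open>n\<close>, halving the neighborhood once per summand. Families
  indexed by \<open>'i\<close> allow repeated summands; symmetry comes at the end, from intersecting
  with the reflected set.\<close>

lemma open_zero_symmetric_sums:
  fixes U :: "'g::topological_ab_group_add set"
  assumes "open U" "0 \<in> U"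
  obtains V where "open V" "0 \<in> V" "\<And>x. x \<in> V \<Longrightarrow> - x \<in> V"
    "\<And>(I :: 'i set) u. finite I \<Longrightarrow> card I \<le> n \<Longrightarrow> (\<And>i. i \<in> I \<Longrightarrow> u i \<in> V) \<Longrightarrow> sum u I \<in> U"
proof -
  have "\<exists>V. open V \<and> 0 \<in> V \<and>
    (\<forall>(I :: 'i set) u. finite I \<longrightarrow> card I \<le> n \<longrightarrow> (\<forall>i\<in>I. u i \<in> V) \<longrightarrow> sum u I \<in> U)"
    using assms
  proof (induction n arbitrary: U)
    case 0
    then show ?case by (intro exI[of _ U]) auto
  next
    case (Suc n)
    obtain V where V: "open V" "0 \<in> V" "\<And>x y. x \<in> V \<Longrightarrow> y \<in> V \<Longrightarrow> x + y \<in> U"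
      using open_zero_halve[OF Suc.prems] by blast
    from Suc.IH[OF V(1,2)] obtain V' where V': "open V'" "0 \<in> V'"
      "\<And>(I :: 'i set) u. finite I \<Longrightarrow> card I \<le> n \<Longrightarrow> (\<forall>i\<in>I. u i \<in> V') \<Longrightarrow> sum u I \<in> V" by blast
    have "sum u I \<in> U"
      if I: "finite I" "card I \<le> Suc n" "\<forall>i\<in>I. u i \<in> V \<inter> V'" for I :: "'i set" and u
    proof (cases "I = {}")
      case True
      then show ?thesis using Suc.prems by simp
    next
      case False
      then obtain i where i: "i \<in> I" by blast
      have "u i + sum u (I - {i}) \<in> U"
        by (intro V(3) V'(3)) (use I i in auto)
      then show ?thesis using I i by (simp add: sum.remove)
    qed
    then show ?case using V V' by (intro exI[of _ "V \<inter> V'"]) auto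
  qed
  then obtain V where V: "open V" "0 \<in> V"
    "\<And>(I :: 'i set) u. finite I \<Longrightarrow> card I \<le> n \<Longrightarrow> (\<forall>i\<in>I. u i \<in> V) \<Longrightarrow> sum u I \<in> U" by blast
  have "open (uminus -` V)"
    using V(1) by (intro open_vimage continuous_intros)
  then show ?thesis
    by (intro that[of "V \<inter> uminus -` V"]) (use V in auto)
qed

text \<open>Compactness gives a finite cover of \<open>'k\<close>, but its centres may lie outside
  the image of \<open>h\<close>. Moving them into the image costs a second summand from
  \<open>O2\<close>.\<close>

lemma precompact_group_covering:
  fixes V :: "'g::{topological_ab_group_add, t2_space} set"
  assumes "precompact_group TYPE('g) TYPE('k::{topological_ab_group_add, t2_space})"
    and "open V" "0 \<in> V"
  obtains T where "finite T" "\<And>x. \<exists>t\<in>T. x - t \<in> V"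
proof -
  obtain h :: "'g \<Rightarrow> 'k" where K: "compact (UNIV :: 'k set)" and h: "Modules.additive h"
    "embedding_map euclidean euclidean h"
    using assms(1) unfolding precompact_group_def by blast
  interpret h: Modules.additive h by (rule h(1))
  have "homeomorphic_map euclidean (top_of_set (range h)) h"
    using h(2) by (simp add: embedding_map_def)
  then have "open_map euclidean (top_of_set (range h)) h" "inj h"
    by (auto simp: homeomorphic_eq_everything_map)
  then have "openin (top_of_set (range h)) (h ` V)"
    using assms(2) by (simp add: open_map_def)
  then obtain O1 where O1: "open O1" "h ` V = range h \<inter> O1"
    by (auto simp: openin_open)
  have "0 \<in> O1" using O1(2) assms(3) h.zero by auto
  then obtain O2 where O2: "open O2" "0 \<in> O2" "\<And>x. x \<in> O2 \<Longrightarrow> - x \<in> O2"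
    "\<And>(I :: nat set) u. finite I \<Longrightarrow> card I \<le> 2 \<Longrightarrow> (\<And>i. i \<in> I \<Longrightarrow> u i \<in> O2) \<Longrightarrow> sum u I \<in> O1"
    using open_zero_symmetric_sums[OF O1(1), where n = 2 and ?'i = nat] by blast
  have "open ((\<lambda>x. x - k) -` O2)" for k
    using O2(1) by (intro open_vimage continuous_intros)
  moreover have "UNIV \<subseteq> (\<Union>k\<in>UNIV. (\<lambda>x. x - k) -` O2)"
  proof
    fix x
    show "x \<in> (\<Union>k\<in>UNIV. (\<lambda>x. x - k) -` O2)" using O2(2) by (intro UN_I[of x]) auto
  qed
  ultimately obtain C where C: "finite C" "UNIV \<subseteq> (\<Union>k\<in>C. (\<lambda>x. x - k) -` O2)"
    using compactE_image[OF K, of UNIV "\<lambda>k. (\<lambda>x. x - k) -` O2"] by auto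
  \<comment> \<open>A point of the group whose image is close to the centre \<open>k\<close>, if
    there is one; otherwise an arbitrary point, which does no harm.\<close>
  define t where "t k = (SOME x. h x - k \<in> O2)" for k
  have "\<exists>s\<in>t ` C. x - s \<in> V" for x
  proof -
    obtain k where k: "k \<in> C" "h x - k \<in> O2" using C(2) by blast
    have t: "h (t k) - k \<in> O2" unfolding t_def by (rule someI[of _ x]) (rule k)
    have "(\<Sum>i\<in>{0, 1 :: nat}. if i = 0 then h x - k else - (h (t k) - k)) \<in> O1"
      by (rule O2(4)) (use k O2(3)[OF t] in auto)
    then have "h (x - t k) \<in> O1" by (simp add: h.diff)
    then have "h (x - t k) \<in> h ` V" using O1(2) by auto
    then have "x - t k \<in> V" using \<open>inj h\<close> by (auto dest: injD)
    then show ?thesis using k by blast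
  qed
  then show ?thesis using that[of "t ` C"] C(1) by blast
qed

section \<open>Periodic functions, axis averages and invariant means\<close>

text \<open>Such functions live on the quotient by the subgroup generated by \<open>L\<close>, which
  is never formed.\<close>

definition periodic :: "'a::ab_group_add set \<Rightarrow> ('a \<Rightarrow> real) \<Rightarrow> bool" where
  "periodic L H \<longleftrightarrow> (\<forall>l\<in>L. \<forall>z. H (z + l) = H z)"

lemma periodic_shift:
  assumes "periodic L H"
  shows "periodic L (\<lambda>z. H (z + x))"
  unfolding periodic_def
proof (intro ballI allI)
  fix l z
  assume "l \<in> L"
  with assms have "H (z + x + l) = H (z + x)" by (simp add: periodic_def)
  then show "H (z + l + x) = H (z + x)" by (simp only: add_ac)
qed

text \<open>For functions with period \<open>int_scale (int N) e\<close> this is the projection onto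
  the functions invariant under \<open>e\<close>.\<close>

definition axis_average :: "nat \<Rightarrow> 'a::ab_group_add \<Rightarrow> ('a \<Rightarrow> real) \<Rightarrow> 'a \<Rightarrow> real" where
  "axis_average N e H z = (\<Sum>k<N. H (z + int_scale (int k) e)) / real N"

lemma periodic_axis_average: "periodic L H \<Longrightarrow> periodic L (axis_average N e H)"
  using periodic_shift[of L H] unfolding periodic_def axis_average_def by (auto intro!: sum.cong)

text \<open>A shift by \<open>e\<close> rotates the \<open>N\<close> summands cyclically, the last
  one wrapping round by periodicity.\<close>

lemma axis_average_invariant:
  assumes "periodic L H" "int_scale (int N) e \<in> L"
  shows "axis_average N e H (z + e) = axis_average N e H z"
proof -
  let ?h = "\<lambda>k. H (z + int_scale (int k) e)"
  have "(\<Sum>k<N. H (z + e + int_scale (int k) e)) = (\<Sum>k<N. ?h (Suc k))"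
    by (simp only: int_scale_Suc add_ac)
  also have "\<dots> = (\<Sum>k<N. ?h k) + ?h N - ?h 0"
    using sum.lessThan_Suc_shift[of ?h N] sum.lessThan_Suc[of ?h N] by simp
  also have "?h N = ?h 0" using assms by (simp add: periodic_def)
  finally show ?thesis by (simp add: axis_average_def)
qed

lemma invariant_int_scale:
  assumes "\<And>z. H (z + e) = H z"
  shows "H (z + int_scale (int k) e) = H z"
proof (induction k)
  case (Suc k)
  have "H (z + int_scale (int (Suc k)) e) = H (z + int_scale (int k) e + e)"
    by (simp only: int_scale_Suc add.assoc)
  with Suc show ?case by (simp only: assms)
qed simp

text \<open>With \<open>A\<close> the axis average of \<open>F\<close>, the right side vanishes: the
  remainder has mean zero along \<open>e\<close>.\<close>

lemma axis_average_diff_self: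
  assumes "\<And>z. A (z + e) = A z" "N > 0"
  shows "axis_average N e (\<lambda>z. F z - A z) z = axis_average N e F z - A z"
  using assms(2) invariant_int_scale[of A, OF assms(1)]
  by (simp add: axis_average_def sum_subtractf diff_divide_distrib)

lemma axis_average_close:
  assumes "\<And>k. \<bar>F (z + int_scale (int k) e) - F z\<bar> \<le> \<epsilon>" "N > 0"
  shows "\<bar>F z - axis_average N e F z\<bar> \<le> \<epsilon>"
proof -
  have "F z - axis_average N e F z = (\<Sum>k<N. F z - F (z + int_scale (int k) e)) / real N"
    using assms(2) by (simp add: axis_average_def sum_subtractf diff_divide_distrib)
  also have "\<bar>\<dots>\<bar> \<le> (\<Sum>k<N. \<epsilon>) / real N"
    unfolding abs_divide abs_of_nat
    by (intro divide_right_mono order.trans[OF sum_abs] sum_mono)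
      (use assms(1) in \<open>auto simp: abs_minus_commute\<close>)
  finally show ?thesis using assms(2) by simp
qed

text \<open>Preserves the oscillation bounds along all axes while the axes are averaged one after
  another.\<close>

lemma axis_average_lipschitz:
  assumes "\<And>z. \<bar>F (z + d) - F z\<bar> \<le> \<epsilon>" "N > 0"
  shows "\<bar>axis_average N e F (z + d) - axis_average N e F z\<bar> \<le> \<epsilon>"
proof -
  have "axis_average N e F (z + d) - axis_average N e F z =
      (\<Sum>k<N. F (z + int_scale (int k) e + d) - F (z + int_scale (int k) e)) / real N"
    by (simp add: axis_average_def sum_subtractf diff_divide_distrib add_ac)
  also have "\<bar>\<dots>\<bar> \<le> (\<Sum>k<N. \<epsilon>) / real N"
    unfolding abs_divide abs_of_nat
    by (intro divide_right_mono order.trans[OF sum_abs] sum_mono) (use assms(1) in auto)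
  finally show ?thesis using assms(2) by simp
qed

text \<open>
  \<open>M\<close> models averaging over a finite quotient of \<open>'a\<close> by a subgroup containing \<open>L\<close>.
\<close>

locale invariant_mean =
  fixes M :: "('a::ab_group_add \<Rightarrow> real) \<Rightarrow> real" and L :: "'a set"
  assumes add: "M (\<lambda>z. F z + H z) = M F + M H"
    and scale: "M (\<lambda>z. c * F z) = c * M F"
    and mono: "(\<And>z. F z \<le> H z) \<Longrightarrow> M F \<le> M H"
    and const: "M (\<lambda>_. c) = c"
    and shift: "periodic L H \<Longrightarrow> M (\<lambda>z. H (z + x)) = M H"
begin

lemma minus: "M (\<lambda>z. - F z) = - M F"
  using scale[of "-1" F] by simp

lemma diff: "M (\<lambda>z. F z - H z) = M F - M H"
  using add[of F "\<lambda>z. - H z"] by (simp add: minus)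

lemma sum: "M (\<lambda>z. \<Sum>i\<in>I. F i z) = (\<Sum>i\<in>I. M (F i))"
  by (induction I rule: infinite_finite_induct) (simp_all add: const add)

lemma axis_average:
  assumes "periodic L F" "N > 0"
  shows "M (axis_average N e F) = M F"
proof -
  have "M (axis_average N e F) = M (\<lambda>z. (1 / real N) * (\<Sum>k<N. F (z + int_scale (int k) e)))"
    by (simp add: axis_average_def[abs_def])
  also have "\<dots> = M F"
    using assms by (simp only: scale sum shift) simp
  finally show ?thesis .
qed

text \<open>The invariant factor \<open>A\<close> can be pulled out of the average along
  \<open>e\<close>, so the product has axis average zero; and axis averaging does not change
  \<open>M\<close>.\<close>

lemma orthogonal:
  assumes "periodic L A" "periodic L D" "N > 0"
    and A: "\<And>z. A (z + e) = A z" and D: "\<And>z. axis_average N e D z = 0"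
  shows "M (\<lambda>z. A z * D z) = 0"
proof -
  have per: "periodic L (\<lambda>z. A z * D z)" using assms(1,2) by (simp add: periodic_def)
  have "axis_average N e (\<lambda>z. A z * D z) z = A z * axis_average N e D z" for z
    by (simp add: axis_average_def invariant_int_scale[of A, OF A] sum_distrib_left)
  then have "axis_average N e (\<lambda>z. A z * D z) = (\<lambda>z. 0)" using D by auto
  then show ?thesis using axis_average[OF per assms(3), of e] by (simp add: const)
qed

section \<open>Correlation and energy\<close>

definition corr :: "('a \<Rightarrow> real) \<Rightarrow> ('a \<Rightarrow> real) \<Rightarrow> 'a \<Rightarrow> real" where
  "corr F H x = M (\<lambda>z. F z * H (z + x))"

text \<open>For averaging over a finite group: the sum of the fourth powers of the absolute Fourier
  coefficients of \<open>F\<close>, which is the fourth power of the Gowers U^2 norm.\<close>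

definition energy :: "('a \<Rightarrow> real) \<Rightarrow> real" where
  "energy F = M (\<lambda>x. (corr F F x)\<^sup>2)"

lemma periodic_corr: "periodic L H \<Longrightarrow> periodic L (corr F H)"
  by (simp add: periodic_def corr_def flip: add.assoc)

text \<open>Lets \<open>corr D D\<close> inherit vanishing axis averages from
  \<open>D\<close>.\<close>

lemma axis_average_corr: "axis_average N e (corr F H) x = M (\<lambda>z. F z * axis_average N e H (z + x))"
proof -
  have "axis_average N e (corr F H) x
      = (1 / real N) * M (\<lambda>z. \<Sum>k<N. F z * H (z + (x + int_scale (int k) e)))"
    by (simp add: axis_average_def corr_def sum)
  also have "\<dots> = M (\<lambda>z. (1 / real N) * (\<Sum>k<N. F z * H (z + (x + int_scale (int k) e))))"
    by (simp only: scale)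
  also have "(\<lambda>z. (1 / real N) * (\<Sum>k<N. F z * H (z + (x + int_scale (int k) e))))
      = (\<lambda>z. F z * axis_average N e H (z + x))"
    by (simp add: axis_average_def sum_distrib_left sum_divide_distrib add.assoc)
  finally show ?thesis .
qed

text \<open>One factor of the squared correlation is bounded by the mean of \<open>D^2\<close>,
  using \<open>2ab \<le> a^2 + b^2\<close> and shift invariance, the other by the pointwise bound
  \<open>\<epsilon>^2\<close>.\<close>

lemma energy_le:
  assumes "periodic L D" "\<And>z. \<bar>D z\<bar> \<le> \<epsilon>"
  shows "energy D \<le> \<epsilon>\<^sup>2 * M (\<lambda>z. (D z)\<^sup>2)"
proof -
  have sq: "M (\<lambda>z. (D (z + x))\<^sup>2) = M (\<lambda>z. (D z)\<^sup>2)" for x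
    by (rule shift) (use assms(1) in \<open>simp add: periodic_def\<close>)
  have abs_le: "\<bar>M F\<bar> \<le> M H" if "\<And>z. \<bar>F z\<bar> \<le> H z" for F H
  proof -
    have "F z \<le> H z" "- H z \<le> F z" for z using that[of z] by (auto simp: abs_le_iff)
    then show ?thesis using mono[of F H] mono[of "\<lambda>z. - H z" F] by (simp add: minus abs_le_iff)
  qed
  have 1: "\<bar>corr D D x\<bar> \<le> M (\<lambda>z. (D z)\<^sup>2)" for x
  proof -
    have "\<bar>corr D D x\<bar> \<le> M (\<lambda>z. (1 / 2) * ((D z)\<^sup>2 + (D (z + x))\<^sup>2))"
      unfolding corr_def
    proof (rule abs_le)
      fix z
      show "\<bar>D z * D (z + x)\<bar> \<le> 1 / 2 * ((D z)\<^sup>2 + (D (z + x))\<^sup>2)"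
        using sum_squares_bound[of "\<bar>D z\<bar>" "\<bar>D (z + x)\<bar>"] by (simp add: abs_mult)
    qed
    also have "\<dots> = M (\<lambda>z. (D z)\<^sup>2)" by (simp only: scale add sq) simp
    finally show ?thesis .
  qed
  have "\<epsilon> \<ge> 0" using assms(2)[of 0] by simp
  then have "\<bar>D z * D (z + x)\<bar> \<le> \<epsilon>\<^sup>2" for z x
    unfolding abs_mult power2_eq_square by (intro mult_mono assms) auto
  then have 2: "\<bar>corr D D x\<bar> \<le> \<epsilon>\<^sup>2" for x
    unfolding corr_def using abs_le[of _ "\<lambda>_. \<epsilon>\<^sup>2"] by (simp add: const)
  have "(corr D D x)\<^sup>2 \<le> \<epsilon>\<^sup>2 * M (\<lambda>z. (D z)\<^sup>2)" for x
  proof -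
    have "(corr D D x)\<^sup>2 = \<bar>corr D D x\<bar> * \<bar>corr D D x\<bar>" by (simp add: power2_eq_square)
    also have "\<dots> \<le> \<epsilon>\<^sup>2 * M (\<lambda>z. (D z)\<^sup>2)" by (intro mult_mono 1 2) auto
    finally show ?thesis .
  qed
  then show ?thesis
    unfolding energy_def using mono[of _ "\<lambda>_. \<epsilon>\<^sup>2 * M (\<lambda>z. (D z)\<^sup>2)"] by (simp add: const)
qed

text \<open>
  The part of \<open>F\<close> that is constant along \<open>e\<close> and the part with mean zero along \<open>e\<close> have disjoint
  Fourier supports, so that energies and square norms add up.
\<close>

lemma axis_average_decomposition:
  fixes F :: "'a \<Rightarrow> real" and e :: 'a and N :: nat
  defines "A \<equiv> axis_average N e F"
  assumes F: "periodic L F" and e: "int_scale (int N) e \<in> L" and N: "N > 0"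
    and lip: "\<And>z k. \<bar>F (z + int_scale (int k) e) - F z\<bar> \<le> \<epsilon>"
  shows "energy F - \<epsilon>\<^sup>2 * M (\<lambda>z. (F z)\<^sup>2) \<le> energy A - \<epsilon>\<^sup>2 * M (\<lambda>z. (A z)\<^sup>2)"
    and "M (corr F F) = M (corr A A)"
proof -
  define D where "D z = F z - A z" for z
  have A: "periodic L A" "\<And>z. A (z + e) = A z"
    unfolding A_def by (rule periodic_axis_average[OF F], rule axis_average_invariant[OF F e])
  have D: "periodic L D" "\<And>z. axis_average N e D z = 0" "\<And>z. \<bar>D z\<bar> \<le> \<epsilon>"
  proof -
    show "periodic L D" using A(1) F by (simp add: periodic_def D_def)
    show "axis_average N e D z = 0" for z
      using axis_average_diff_self[of A e N F z] A(2) N by (simp add: D_def[abs_def] A_def)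
    show "\<bar>D z\<bar> \<le> \<epsilon>" for z
      unfolding D_def A_def by (rule axis_average_close[OF lip N])
  qed
  have avg_shift: "axis_average N e (\<lambda>z. D (z + x)) z = axis_average N e D (z + x)" for x z
    by (simp add: axis_average_def add_ac)
  have AD: "corr A D x = 0" for x
    unfolding corr_def
    by (rule orthogonal[of A _ N e])
      (use A D N periodic_shift[OF D(1)] avg_shift in auto)
  have DA: "corr D A x = 0" for x
  proof -
    have "M (\<lambda>z. A (z + x) * D z) = 0"
    proof (rule orthogonal[OF periodic_shift[OF A(1)] D(1) N _ D(2)])
      show "A (z + e + x) = A (z + x)" for z
        using A(2)[of "z + x"] by (simp add: add_ac)
    qed
    then show ?thesis by (simp add: corr_def mult.commute)
  qed
  have FAD: "F = (\<lambda>z. A z + D z)" by (simp add: D_def)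
  have corr: "corr F F x = corr A A x + corr D D x" for x
  proof -
    have "corr F F x = corr A A x + corr A D x + corr D A x + corr D D x"
      unfolding corr_def FAD by (simp add: distrib_left distrib_right add)
    then show ?thesis by (simp add: AD DA)
  qed
  \<comment> \<open>The correlations are again one \<open>e\<close>-invariant function and one with
    mean zero along \<open>e\<close>, so orthogonality applies a second time, now to the
    energies.\<close>
  have cA: "periodic L (corr A A)" "corr A A (x + e) = corr A A x" for x
    using periodic_corr[OF A(1)] A(2) by (auto simp: corr_def simp flip: add.assoc)
  have cD: "periodic L (corr D D)" "axis_average N e (corr D D) x = 0" for x
    using periodic_corr[OF D(1)] D(2) by (auto simp: axis_average_corr const)
  have "axis_average N e (corr D D) = (\<lambda>_. 0)" using cD(2) by auto
  then have "M (corr D D) = 0"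
    using axis_average[OF cD(1) N, of e] by (simp add: const)
  then show "M (corr F F) = M (corr A A)"
    using add[of "corr A A" "corr D D"] by (simp flip: corr)
  have square: "M (\<lambda>z. (X z + Y z)\<^sup>2) = M (\<lambda>z. (X z)\<^sup>2) + M (\<lambda>z. (Y z)\<^sup>2)"
    if "M (\<lambda>z. X z * Y z) = 0" for X Y
    using that by (simp add: power2_sum add scale mult.assoc)
  have "energy F = energy A + energy D"
    unfolding energy_def corr
    by (rule square, rule orthogonal[of _ _ N e]) (use cA cD N in auto)
  moreover have "M (\<lambda>z. (F z)\<^sup>2) = M (\<lambda>z. (A z)\<^sup>2) + M (\<lambda>z. (D z)\<^sup>2)"
    unfolding FAD by (rule square, rule orthogonal[of _ _ N e]) (use A D N in auto)
  \<comment> \<open>The energy lost with \<open>D\<close> is at most \<open>\<epsilon>^2\<close>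
    times the square norm lost with \<open>D\<close>.\<close>
  ultimately show "energy F - \<epsilon>\<^sup>2 * M (\<lambda>z. (F z)\<^sup>2) \<le> energy A - \<epsilon>\<^sup>2 * M (\<lambda>z. (A z)\<^sup>2)"
    using energy_le[OF D(1,3)] by (simp add: distrib_left)
qed

text \<open>The axes in \<open>B\<close> are averaged out one at a time. This keeps the means of the
  function and of its autocorrelation and never decreases the energy minus
  \<open>\<epsilon>^2\<close> times the square norm. By \<open>ergodic\<close> the final function is
  constant.\<close>

lemma energy_bound:
  fixes e :: "'b \<Rightarrow> 'a"
  assumes B: "finite B" and N: "N > 0" and e: "\<And>b. b \<in> B \<Longrightarrow> int_scale (int N) (e b) \<in> L"
    and F: "periodic L F"
    and lip: "\<And>b z k. b \<in> B \<Longrightarrow> \<bar>F (z + int_scale (int k) (e b)) - F z\<bar> \<le> \<epsilon>"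
    and ergodic: "\<And>H z. periodic L H \<Longrightarrow> (\<And>b z. b \<in> B \<Longrightarrow> H (z + e b) = H z) \<Longrightarrow> H z = H 0"
  shows "energy F \<le> (M F) ^ 4 + \<epsilon>\<^sup>2 * M (\<lambda>z. (F z)\<^sup>2)" and "M (corr F F) = (M F)\<^sup>2"
proof -
  have "\<exists>H. periodic L H \<and> (\<forall>b\<in>B. \<forall>z k. \<bar>H (z + int_scale (int k) (e b)) - H z\<bar> \<le> \<epsilon>) \<and>
      (\<forall>b\<in>C. \<forall>z. H (z + e b) = H z) \<and> M H = M F \<and> M (corr F F) = M (corr H H) \<and>
      energy F - \<epsilon>\<^sup>2 * M (\<lambda>z. (F z)\<^sup>2) \<le> energy H - \<epsilon>\<^sup>2 * M (\<lambda>z. (H z)\<^sup>2)"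
    if "finite C" "C \<subseteq> B" for C
    using that
  proof (induction C)
    case empty
    show ?case by (rule exI[of _ F]) (use F lip in auto)
  next
    case (insert c C)
    then obtain H where H: "periodic L H"
      "\<And>b z k. b \<in> B \<Longrightarrow> \<bar>H (z + int_scale (int k) (e b)) - H z\<bar> \<le> \<epsilon>"
      "\<And>b z. b \<in> C \<Longrightarrow> H (z + e b) = H z" "M H = M F" "M (corr F F) = M (corr H H)"
      "energy F - \<epsilon>\<^sup>2 * M (\<lambda>z. (F z)\<^sup>2) \<le> energy H - \<epsilon>\<^sup>2 * M (\<lambda>z. (H z)\<^sup>2)"
      by auto
    have c: "c \<in> B" using insert.prems by simp
    define A where "A = axis_average N (e c) H"
    \<comment> \<open>Translations commute, so averaging along \<open>e c\<close> preserves the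
      invariance gained along earlier axes.\<close>
    have "A (z + e b) = A z" if "b \<in> insert c C" for b z
    proof (cases "b = c")
      case True
      then show ?thesis unfolding A_def using axis_average_invariant[OF H(1) e[OF c]] by simp
    next
      case False
      with that have "b \<in> C" by simp
      then have "H (z + e b + int_scale (int k) (e c)) = H (z + int_scale (int k) (e c))" for k
        using H(3)[of b "z + int_scale (int k) (e c)"] by (simp add: add_ac)
      then show ?thesis unfolding A_def by (simp add: axis_average_def)
    qed
    moreover note axis_average_decomposition[OF H(1) e[OF c] N H(2)[OF c], folded A_def]
    moreover have "\<bar>A (z + int_scale (int k) (e b)) - A z\<bar> \<le> \<epsilon>" if "b \<in> B" for b z k
      unfolding A_def by (rule axis_average_lipschitz[OF _ N]) (rule H(2)[OF that])
    ultimately show ?case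
      using H(4-6) periodic_axis_average[OF H(1), of N "e c"] axis_average[OF H(1) N, of "e c"]
      by (intro exI[of _ A]) (auto simp flip: A_def)
  qed
  from this[OF B subset_refl] obtain H where H: "periodic L H"
      "\<And>b z. b \<in> B \<Longrightarrow> H (z + e b) = H z" "M H = M F" "M (corr F F) = M (corr H H)"
      "energy F - \<epsilon>\<^sup>2 * M (\<lambda>z. (F z)\<^sup>2) \<le> energy H - \<epsilon>\<^sup>2 * M (\<lambda>z. (H z)\<^sup>2)"
    by blast
  define c where "c = H 0"
  have "H = (\<lambda>_. c)" using ergodic[OF H(1,2)] by (auto simp: c_def)
  then have c: "M F = c" "corr H H = (\<lambda>_. c\<^sup>2)" "energy H = c ^ 4" "M (\<lambda>z. (H z)\<^sup>2) = c\<^sup>2"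
    using H(3) by (auto simp: const corr_def[abs_def] energy_def power2_eq_square power4_eq_xxxx)
  have "0 \<le> \<epsilon>\<^sup>2 * c\<^sup>2" by simp
  with H(5) show "energy F \<le> (M F) ^ 4 + \<epsilon>\<^sup>2 * M (\<lambda>z. (F z)\<^sup>2)"
    unfolding c by linarith
  show "M (corr F F) = (M F)\<^sup>2" using H(4) c by (simp add: const)
qed

text \<open>The autocorrelation and its translate by \<open>w\<close> have disjoint supports, so
  their sum has mean square \<open>2 * energy F\<close>. Its mean is twice that of
  \<open>corr F F\<close>, and its variance is nonnegative.\<close>

lemma energy_lower_bound:
  assumes "periodic L F" and "\<And>x. corr F F x = 0 \<or> corr F F (x + w) = 0"
  shows "2 * (M (corr F F))\<^sup>2 \<le> energy F"
proof -
  define c where "c = M (corr F F)"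
  define K where "K = corr F F"
  have K: "periodic L K" unfolding K_def by (rule periodic_corr[OF assms(1)])
  have sh: "M (\<lambda>x. K (x + w)) = c" "M (\<lambda>x. (K (x + w))\<^sup>2) = energy F"
    using shift[OF K, of w] shift[of "\<lambda>x. (K x)\<^sup>2" w] K
    by (auto simp: c_def K_def energy_def periodic_def)
  have "0 \<le> M (\<lambda>x. (K x + K (x + w) - 2 * c)\<^sup>2)"
    using mono[of "\<lambda>_. 0" "\<lambda>x. (K x + K (x + w) - 2 * c)\<^sup>2"] by (simp add: const)
  also have "(\<lambda>x. (K x + K (x + w) - 2 * c)\<^sup>2) =
      (\<lambda>x. (K x)\<^sup>2 + (K (x + w))\<^sup>2 + 4 * c\<^sup>2 - (4 * c) * K x - (4 * c) * K (x + w))"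
  proof
    fix x
    show "(K x + K (x + w) - 2 * c)\<^sup>2 =
        (K x)\<^sup>2 + (K (x + w))\<^sup>2 + 4 * c\<^sup>2 - (4 * c) * K x - (4 * c) * K (x + w)"
      using assms(2)[of x] by (auto simp: K_def power2_eq_square algebra_simps)
  qed
  also have "M (\<lambda>x. (K x)\<^sup>2 + (K (x + w))\<^sup>2 + 4 * c\<^sup>2 - (4 * c) * K x - (4 * c) * K (x + w))
      = 2 * energy F + 4 * c\<^sup>2 - 4 * c * c - 4 * c * c"
    by (simp only: add diff scale const sh) (simp add: K_def energy_def c_def)
  finally show ?thesis by (simp add: power2_eq_square c_def)
qed

end

section \<open>Averaging over \<open>(\<int>/N)^B\<close>\<close>

text \<open>Coordinates outside \<open>B\<close> are pinned to 0, so that the set of representatives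
  is finite for finite \<open>B\<close>.\<close>

definition residue_box :: "'b set \<Rightarrow> nat \<Rightarrow> ('b \<Rightarrow> int) set" where
  "residue_box B N = {z. \<forall>b. (b \<in> B \<longrightarrow> z b \<in> {0..<int N}) \<and> (b \<notin> B \<longrightarrow> z b = 0)}"

definition box_mean :: "'b set \<Rightarrow> nat \<Rightarrow> (('b \<Rightarrow> int) \<Rightarrow> real) \<Rightarrow> real" where
  "box_mean B N F = (\<Sum>z\<in>residue_box B N. F z) / real (card (residue_box B N))"

text \<open>Coordinates outside \<open>B\<close> are unrestricted, so periodic functions depend on
  the coordinates in \<open>B\<close> only.\<close>

definition period_lattice :: "'b set \<Rightarrow> nat \<Rightarrow> ('b \<Rightarrow> int) set" where
  "period_lattice B N = {l. \<forall>b\<in>B. int N dvd l b}"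

definition reduce_mod :: "'b set \<Rightarrow> nat \<Rightarrow> ('b \<Rightarrow> int) \<Rightarrow> 'b \<Rightarrow> int" where
  "reduce_mod B N z = (\<lambda>b. if b \<in> B then z b mod int N else 0)"

definition axis_vec :: "'b \<Rightarrow> 'b \<Rightarrow> int" where
  "axis_vec b = (\<lambda>c. if c = b then 1 else 0)"

lemma int_scale_axis_vec: "int_scale k (axis_vec b) = (\<lambda>c. if c = b then k else 0)"
  by (auto simp: axis_vec_def int_scale_fun)

lemma finite_residue_box: "finite B \<Longrightarrow> finite (residue_box B N)"
  unfolding residue_box_def by (rule finite_set_of_finite_funs) auto

lemma reduce_mod_in_residue_box: "N > 0 \<Longrightarrow> reduce_mod B N z \<in> residue_box B N"
  by (simp add: reduce_mod_def residue_box_def)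

lemma periodic_reduce_mod:
  assumes "periodic (period_lattice B N) H"
  shows "H (reduce_mod B N z) = H z"
proof -
  have "reduce_mod B N z - z \<in> period_lattice B N"
    by (auto simp: period_lattice_def reduce_mod_def simp flip: mod_eq_dvd_iff)
  with assms have "H (z + (reduce_mod B N z - z)) = H z" unfolding periodic_def by blast
  then show ?thesis by simp
qed

text \<open>For shift invariance: translation followed by reduction permutes the box.\<close>

lemma invariant_mean_box:
  assumes "finite B" "N > 0"
  shows "invariant_mean (box_mean B N) (period_lattice B N)"
proof
  have "residue_box B N \<noteq> {}" using reduce_mod_in_residue_box[OF assms(2)] by blast
  then have card: "card (residue_box B N) > 0" using finite_residue_box[OF assms(1)] by (simp add: card_gt_0_iff)
  show "box_mean B N (\<lambda>z. F z + H z) = box_mean B N F + box_mean B N H" for F H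
    by (simp add: box_mean_def sum.distrib add_divide_distrib)
  show "box_mean B N (\<lambda>z. c * F z) = c * box_mean B N F" for c F
    by (simp add: box_mean_def sum_distrib_left)
  show "box_mean B N F \<le> box_mean B N H" if "\<And>z. F z \<le> H z" for F H
    unfolding box_mean_def by (intro divide_right_mono sum_mono that) simp
  show "box_mean B N (\<lambda>_. c) = c" for c
    using card by (simp add: box_mean_def)
  show "box_mean B N (\<lambda>z. H (z + x)) = box_mean B N H" if "periodic (period_lattice B N) H" for H x
  proof -
    have sub_add: "reduce_mod B N (reduce_mod B N (z + x) - x) = z"
      and add_sub: "reduce_mod B N (reduce_mod B N (z - x) + x) = z" if "z \<in> residue_box B N" for z
      using that by (auto simp: reduce_mod_def residue_box_def mod_diff_left_eq mod_add_left_eq)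
    have "(\<Sum>z\<in>residue_box B N. H (z + x)) = (\<Sum>z\<in>residue_box B N. H (reduce_mod B N (z + x)))"
      by (simp add: periodic_reduce_mod[OF that])
    also have "\<dots> = (\<Sum>z\<in>residue_box B N. H z)"
      by (rule sum.reindex_bij_witness[where i = "\<lambda>z. reduce_mod B N (z - x)"
            and j = "\<lambda>z. reduce_mod B N (z + x)"])
        (use sub_add add_sub reduce_mod_in_residue_box[OF assms(2)] in auto)
    finally show ?thesis by (simp add: box_mean_def)
  qed
qed

text \<open>Supplies the hypothesis \<open>ergodic\<close> of \<open>energy_bound\<close>: the
  representative of \<open>z\<close> is reached from 0 one axis at a time, by nonnegative
  steps.\<close>

lemma axis_invariant_imp_constant:
  assumes "finite B" "N > 0" "periodic (period_lattice B N) H"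
    and inv: "\<And>b z. b \<in> B \<Longrightarrow> H (z + axis_vec b) = H z"
  shows "H z = H 0"
proof -
  define y where "y = reduce_mod B N z"
  have y: "y \<in> residue_box B N" unfolding y_def by (rule reduce_mod_in_residue_box[OF assms(2)])
  have "H (\<lambda>b. if b \<in> C then y b else 0) = H 0" if "finite C" "C \<subseteq> B" for C
    using that
  proof (induction C)
    case empty
    then show ?case by (simp add: zero_fun_def)
  next
    case (insert c C)
    have "y c \<ge> 0" using y insert.prems by (auto simp: residue_box_def)
    then have "(\<lambda>b. if b \<in> insert c C then y b else 0) =
        (\<lambda>b. if b \<in> C then y b else 0) + int_scale (int (nat (y c))) (axis_vec c)"
      using insert.hyps by (auto simp: int_scale_axis_vec)
    moreover have "H (x + int_scale (int k) (axis_vec c)) = H x" for x k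
      by (rule invariant_int_scale[of H], rule inv) (use insert.prems in simp)
    ultimately show ?case using insert by (simp only: insert_subset)
  qed
  from this[OF assms(1) subset_refl] have "H (\<lambda>b. if b \<in> B then y b else 0) = H 0" .
  also have "(\<lambda>b. if b \<in> B then y b else 0) = y" using y by (auto simp: residue_box_def)
  finally show ?thesis by (simp add: y_def periodic_reduce_mod[OF assms(3)] zero_fun_def)
qed

section \<open>Pigeonhole arguments in precompact groups\<close>

text \<open>Two indices \<open>n\<close> share the cells of a finite cover chosen for all points
  \<open>s n b\<close>. Applied to multiples of the elements of \<open>B\<close> and, with a
  one-point \<open>B\<close>, to partial sums.\<close>

lemma precompact_pigeonhole:
  fixes V :: "'g::{topological_ab_group_add, t2_space} set" and s :: "nat \<Rightarrow> 'b \<Rightarrow> 'g"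
  assumes "precompact_group TYPE('g) TYPE('k::{topological_ab_group_add, t2_space})"
    and "open V" "0 \<in> V" "finite B"
  obtains i j where "i < j" "\<And>b. b \<in> B \<Longrightarrow> s j b - s i b \<in> V"
proof -
  obtain V' where V': "open V'" "0 \<in> V'" "\<And>x. x \<in> V' \<Longrightarrow> - x \<in> V'"
    "\<And>(I :: nat set) u. finite I \<Longrightarrow> card I \<le> 2 \<Longrightarrow> (\<And>i. i \<in> I \<Longrightarrow> u i \<in> V') \<Longrightarrow> sum u I \<in> V"
    using open_zero_symmetric_sums[OF assms(2,3), where n = 2 and ?'i = nat] by blast
  obtain T where T: "finite T" "\<And>x. \<exists>t\<in>T. x - t \<in> V'"
    using precompact_group_covering[OF assms(1) V'(1,2)] by blast
  from T(2) obtain t where t: "\<And>x. t x \<in> T" "\<And>x. x - t x \<in> V'" by metis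
  \<comment> \<open>Restricting to \<open>B\<close> leaves only finitely many possible
    colors.\<close>
  define color where "color n = (\<lambda>b\<in>B. t (s n b))" for n
  have "range color \<subseteq> B \<rightarrow>\<^sub>E T" using t(1) by (auto simp: color_def)
  then have "finite (range color)"
    using finite_PiE[of B "\<lambda>_. T"] T(1) assms(4) by (meson finite_subset)
  then have "\<not> inj color" using finite_imageD by blast
  then obtain i j where "i < j" "color i = color j"
    unfolding inj_def by (metis linorder_neqE_nat)
  then have eq: "t (s i b) = t (s j b)" if "b \<in> B" for b
    using that by (metis color_def restrict_apply')
  have "s j b - s i b \<in> V" if "b \<in> B" for b
  proof -
    have "(\<Sum>l\<in>{0, 1 :: nat}. if l = 0 then s j b - t (s j b) else - (s i b - t (s i b))) \<in> V"
      by (rule V'(4)) (use t(2)[of "s j b"] V'(3)[OF t(2)[of "s i b"]] in auto)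
    then show ?thesis using eq[OF that] by simp
  qed
  with \<open>i < j\<close> show ?thesis using that by blast
qed

text \<open>Dirichlet's simultaneous approximation: \<open>N\<close> is the difference of two
  indices at which the multiples of every \<open>b\<close> are close.\<close>

lemma precompact_simultaneous_return:
  fixes V :: "'g::{topological_ab_group_add, t2_space} set"
  assumes "precompact_group TYPE('g) TYPE('k::{topological_ab_group_add, t2_space})"
    and "open V" "0 \<in> V" "finite B"
  obtains N where "N > 0" "\<And>b. b \<in> B \<Longrightarrow> int_scale (int N) b \<in> V"
proof -
  obtain i j where ij: "i < j" "\<And>b. b \<in> B \<Longrightarrow> int_scale (int j) b - int_scale (int i) b \<in> V"
    using precompact_pigeonhole[OF assms, of "\<lambda>n. int_scale (int n)"] by metis
  show ?thesis
    by (rule that[of "j - i"]) (use ij in \<open>auto simp: of_nat_diff int_scale_diff\<close>)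
qed

lemma int_scale_in_sums:
  assumes "\<And>(I :: nat set) u. finite I \<Longrightarrow> card I \<le> K \<Longrightarrow> (\<And>i. i \<in> I \<Longrightarrow> u i \<in> V) \<Longrightarrow> sum u I \<in> U"
    and "x \<in> V" "- x \<in> V" "\<bar>c\<bar> \<le> int K"
  shows "int_scale c x \<in> U"
proof (cases "0 \<le> c")
  case True
  with assms(1)[of "{..<nat c}" "\<lambda>_. x"] assms(2,4) show ?thesis by (simp add: int_scale_def)
next
  case False
  with assms(1)[of "{..<nat (- c)}" "\<lambda>_. - x"] assms(3,4) show ?thesis
    by (simp add: int_scale_def sum_negf del: sum_constant)
qed

section \<open>A bump function with small steps\<close>

lemma lipschitz_bump:
  fixes V :: "'g::topological_ab_group_add set"
  assumes "open V" "0 \<in> V" "n > 0"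
  obtains W and f :: "'g \<Rightarrow> real" where "open W" "0 \<in> W"
    "\<And>x w. w \<in> W \<Longrightarrow> \<bar>f (x + w) - f x\<bar> \<le> 1 / real n"
    "\<And>x. x \<in> V \<Longrightarrow> f x = 1" "\<And>x. f x \<noteq> 0 \<Longrightarrow> \<exists>v\<in>V. \<exists>v'\<in>V. x = v + v'"
    "\<And>x. 0 \<le> f x" "\<And>x. f x \<le> 1"
proof -
  obtain W where W: "open W" "0 \<in> W" "\<And>x. x \<in> W \<Longrightarrow> - x \<in> W"
    "\<And>(I :: nat set) u. finite I \<Longrightarrow> card I \<le> n \<Longrightarrow> (\<And>i. i \<in> I \<Longrightarrow> u i \<in> W) \<Longrightarrow> sum u I \<in> V"
    using open_zero_symmetric_sums[OF assms(1,2), where n = n and ?'i = nat] by blast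
  \<comment> \<open>\<open>f\<close> is a staircase on the sets \<open>V + j W\<close>, a translation by an element of \<open>W\<close> being one step.\<close>
  define A where "A j = {v + (\<Sum>i<j. u i) | v u. v \<in> V \<and> (\<forall>i<j. u i \<in> W)}" for j :: nat
  define S where "S x = {j \<in> {..<n}. x \<in> A j}" for x
  define f where "f x = real (card (S x)) / real n" for x
  have A_Suc: "x + w \<in> A (Suc j)" if "x \<in> A j" "w \<in> W" for x w j
  proof -
    from that(1) obtain v u where x: "x = v + (\<Sum>i<j. u i)" "v \<in> V" "\<forall>i<j. u i \<in> W"
      unfolding A_def by blast
    have "x + w = v + (\<Sum>i<Suc j. (u(j := w)) i)"
      unfolding x(1) by (simp add: add.assoc)
    moreover have "\<forall>i<Suc j. (u(j := w)) i \<in> W" using x(3) that(2) by (auto simp: less_Suc_eq)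
    ultimately show ?thesis unfolding A_def using x(2) by blast
  qed
  have card_le: "card (S x) \<le> card (S (x + w)) + 1" if "w \<in> W" for x w
  proof -
    \<comment> \<open>A step by \<open>w\<close> raises every level by one; only the top one can
      leave the range, and it becomes the extra element \<open>n\<close>.\<close>
    have "card (S x) = card (Suc ` S x)" by (simp add: card_image)
    also have "\<dots> \<le> card (insert n (S (x + w)))"
      by (rule card_mono) (use A_Suc[OF _ that] in \<open>auto simp: S_def\<close>)
    also have "\<dots> \<le> card (S (x + w)) + 1" by (simp add: S_def card_insert_if)
    finally show ?thesis .
  qed
  have "\<bar>f (x + w) - f x\<bar> \<le> 1 / real n" if "w \<in> W" for x w
  proof -
    have "card (S x) \<le> card (S (x + w)) + 1" "card (S (x + w)) \<le> card (S x) + 1"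
      using card_le[OF that, of x] card_le[OF W(3)[OF that], of "x + w"] by simp_all
    then have "\<bar>real (card (S (x + w))) - real (card (S x))\<bar> \<le> 1" by linarith
    then show ?thesis
      unfolding f_def by (simp add: divide_right_mono flip: diff_divide_distrib)
  qed
  moreover have "f x = 1" if "x \<in> V" for x
  proof -
    have "x \<in> A j" for j
      unfolding A_def using that W(2) by (auto intro!: exI[of _ x] exI[of _ "\<lambda>_. 0"])
    then have "S x = {..<n}" by (auto simp: S_def)
    then show ?thesis using assms(3) by (simp add: f_def)
  qed
  moreover have "\<exists>v\<in>V. \<exists>v'\<in>V. x = v + v'" if "f x \<noteq> 0" for x
  proof -
    from that have "S x \<noteq> {}" by (auto simp: f_def)
    then obtain j where j: "j < n" "x \<in> A j" by (auto simp: S_def)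
    then obtain v u where x: "x = v + (\<Sum>i<j. u i)" "v \<in> V" "\<forall>i<j. u i \<in> W"
      unfolding A_def by blast
    moreover have "(\<Sum>i<j. u i) \<in> V" by (rule W(4)) (use j x in auto)
    ultimately show ?thesis by blast
  qed
  moreover have "f x \<le> 1" for x
    using card_mono[of "{..<n}" "S x"] assms(3) by (auto simp: f_def S_def)
  ultimately show ?thesis by (intro that[of W f]) (use W in \<open>auto simp: f_def\<close>)
qed

section \<open>Sums of small cyclic subgroups\<close>

text \<open>The point is uniformity: \<open>W\<close> is fixed before \<open>B\<close> and
  \<open>z\<close>. The later choices \<open>V1\<close>, \<open>V2\<close> and \<open>N\<close> only
  control error terms.\<close>

lemma precompact_small_cyclic_sums:
  fixes U :: "'g::{topological_ab_group_add, t2_space} set"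
  assumes pc: "precompact_group TYPE('g) TYPE('k::{topological_ab_group_add, t2_space})"
    and "open U" "0 \<in> U"
  obtains W where "open W" "0 \<in> W"
    "\<And>B z. finite B \<Longrightarrow> (\<And>b k. b \<in> B \<Longrightarrow> int_scale k b \<in> W) \<Longrightarrow> (\<Sum>b\<in>B. int_scale (z b) b) \<in> U"
proof -
  \<comment> \<open>Nine summands: two from each of four points in the support of \<open>F\<close>,
    and one for the additivity defect of \<open>\<sigma>\<close>.\<close>
  obtain V where V: "open V" "0 \<in> V" "\<And>x. x \<in> V \<Longrightarrow> - x \<in> V"
    "\<And>(I :: nat set) u. finite I \<Longrightarrow> card I \<le> 9 \<Longrightarrow> (\<And>i. i \<in> I \<Longrightarrow> u i \<in> V) \<Longrightarrow> sum u I \<in> U"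
    using open_zero_symmetric_sums[OF assms(2,3), where n = 9 and ?'i = nat] by blast
  have sum9: "v1 + v2 + v3 + v4 + v5 + v6 + v7 + v8 + v9 \<in> U"
    if "v1 \<in> V" "v2 \<in> V" "v3 \<in> V" "v4 \<in> V" "v5 \<in> V" "v6 \<in> V" "v7 \<in> V" "v8 \<in> V" "v9 \<in> V"
    for v1 v2 v3 v4 v5 v6 v7 v8 v9
  proof -
    let ?vs = "[v1, v2, v3, v4, v5, v6, v7, v8, v9]"
    have "(\<Sum>i<length ?vs. ?vs ! i) \<in> U"
    proof (rule V(4))
      fix i
      assume "i \<in> {..<length ?vs}"
      then have "?vs ! i \<in> set ?vs" by (intro nth_mem) simp
      also have "set ?vs \<subseteq> V" using that by simp
      finally show "?vs ! i \<in> V" .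
    qed simp_all
    also have "(\<Sum>i<length ?vs. ?vs ! i) = sum_list ?vs"
      by (simp only: sum_list_sum_nth atLeast0LessThan)
    finally show ?thesis by (simp add: add.assoc)
  qed
  obtain T where T: "finite T" "\<And>x. \<exists>t\<in>T. x - t \<in> V"
    using precompact_group_covering[OF pc V(1,2)] by blast
  define m where "m = card T"
  have "m > 0" using T by (auto simp: m_def card_gt_0_iff)
  \<comment> \<open>Makes \<open>1 / n\<close> smaller than \<open>1 / m^2\<close>, hence than
    \<open>c^2\<close>, whereas the energy bounds will give \<open>c^2 \<le> 1 / n\<close>.\<close>
  define n where "n = m\<^sup>2 + 1"
  obtain W and f :: "'g \<Rightarrow> real" where W: "open W" "0 \<in> W"
    and f_lip: "\<And>x w. w \<in> W \<Longrightarrow> \<bar>f (x + w) - f x\<bar> \<le> 1 / real n"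
    and f_V: "\<And>x. x \<in> V \<Longrightarrow> f x = 1" "\<And>x. f x \<noteq> 0 \<Longrightarrow> \<exists>v\<in>V. \<exists>v'\<in>V. x = v + v'"
    and f_bounds: "\<And>x. 0 \<le> f x" "\<And>x. f x \<le> 1"
    using lipschitz_bump[OF V(1,2), of n] by (metis n_def add_gr_0 zero_less_one)
  have "(\<Sum>b\<in>B. int_scale (z b) b) \<in> U"
    if B: "finite B" and small: "\<And>b k. b \<in> B \<Longrightarrow> int_scale k b \<in> W" for B z
  proof (rule ccontr)
    assume notin: "(\<Sum>b\<in>B. int_scale (z b) b) \<notin> U"
    \<comment> \<open>Bounds the defect in units of \<open>N\<close>: a coefficient consists of
      \<open>z b\<close> and two differences of residues, each less than \<open>N\<close> in
      absolute value.\<close>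
    define K where "K = 2 + (\<Sum>b\<in>B. nat \<bar>z b\<bar>)"
    \<comment> \<open>\<open>V2\<close> absorbs up to \<open>K\<close> copies of a single
      \<open>N b\<close>, and \<open>V1\<close> then the sum over \<open>B\<close>.\<close>
    obtain V1 where V1: "open V1" "0 \<in> V1" "\<And>x. x \<in> V1 \<Longrightarrow> - x \<in> V1"
      "\<And>(I :: 'g set) u. finite I \<Longrightarrow> card I \<le> card B \<Longrightarrow> (\<And>i. i \<in> I \<Longrightarrow> u i \<in> V1) \<Longrightarrow> sum u I \<in> V"
      by (fact open_zero_symmetric_sums[OF V(1,2), where n = "card B" and ?'i = 'g])
    obtain V2 where V2: "open V2" "0 \<in> V2" "\<And>x. x \<in> V2 \<Longrightarrow> - x \<in> V2"
      "\<And>(I :: nat set) u. finite I \<Longrightarrow> card I \<le> K \<Longrightarrow> (\<And>i. i \<in> I \<Longrightarrow> u i \<in> V2) \<Longrightarrow> sum u I \<in> V1"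
      by (fact open_zero_symmetric_sums[OF V1(1,2), where n = K and ?'i = nat])
    obtain N where N: "N > 0" "\<And>b. b \<in> B \<Longrightarrow> int_scale (int N) b \<in> V2"
      using precompact_simultaneous_return[OF pc V2(1,2) B] by blast
    \<comment> \<open>The defect of additivity of \<open>\<sigma>\<close> is a combination of the \<open>N b\<close> with bounded coefficients.\<close>
    have error: "(\<Sum>b\<in>B. int_scale (d b) b) \<in> V"
      if d: "\<And>b. b \<in> B \<Longrightarrow> int N dvd d b" "\<And>b. b \<in> B \<Longrightarrow> \<bar>d b\<bar> \<le> int N * int K" for d
    proof (rule V1(4))
      fix b
      assume b: "b \<in> B"
      from d(1)[OF b] obtain c where c: "d b = int N * c" by blast
      with d(2)[OF b] N(1) have "\<bar>c\<bar> \<le> int K" by (simp add: abs_mult)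
      with V2(4) N(2)[OF b] V2(3)[OF N(2)[OF b]] have "int_scale c (int_scale (int N) b) \<in> V1"
        by (rule int_scale_in_sums)
      then show "int_scale (d b) b \<in> V1" by (simp add: c mult.commute flip: int_scale_mult)
    qed (use B in auto)
    define \<sigma> where "\<sigma> y = (\<Sum>b\<in>B. int_scale (y b mod int N) b)" for y
    interpret invariant_mean "box_mean B N" "period_lattice B N"
      by (rule invariant_mean_box[OF B N(1)])
    have \<sigma>_periodic: "\<sigma> (y + l) = \<sigma> y" if "l \<in> period_lattice B N" for y l
    proof -
      have "(y b + l b) mod int N = y b mod int N" if "b \<in> B" for b
        using \<open>l \<in> period_lattice B N\<close> that mod_add_right_eq[of "y b" "l b" "int N"]
        by (simp add: period_lattice_def)
      then show ?thesis unfolding \<sigma>_def by (intro sum.cong) auto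
    qed
    have per: "periodic (period_lattice B N) (\<lambda>y. f (\<sigma> y - g))" for g
      by (simp add: periodic_def \<sigma>_periodic)
    \<comment> \<open>The translates of \<open>f\<close> by the \<open>m\<close> elements of
      \<open>T\<close> add up to at least 1 everywhere, so one of them has mean at least
      \<open>1 / m\<close>.\<close>
    obtain g where g: "1 / real m \<le> box_mean B N (\<lambda>y. f (\<sigma> y - g))"
    proof (rule ccontr)
      assume "\<not> thesis"
      then have "box_mean B N (\<lambda>y. f (\<sigma> y - g)) < 1 / real m" for g
        using that[of g] by (meson linorder_not_le)
      then have "(\<Sum>g\<in>T. box_mean B N (\<lambda>y. f (\<sigma> y - g))) < (\<Sum>g\<in>T. 1 / real m)"
        using T \<open>m > 0\<close> by (intro sum_strict_mono) (auto simp: m_def card_gt_0_iff)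
      also have "\<dots> = 1" using \<open>m > 0\<close> by (simp add: m_def)
      also have "1 = box_mean B N (\<lambda>_. 1)" by (simp add: const)
      also have "\<dots> \<le> box_mean B N (\<lambda>y. \<Sum>g\<in>T. f (\<sigma> y - g))"
      proof (rule mono)
        fix y
        obtain t where t: "t \<in> T" "\<sigma> y - t \<in> V" using T(2) by blast
        then have "1 = f (\<sigma> y - t)" by (simp add: f_V)
        also have "\<dots> \<le> (\<Sum>g\<in>T. f (\<sigma> y - g))"
          using T(1) t(1) f_bounds(1) by (intro member_le_sum) auto
        finally show "1 \<le> (\<Sum>g\<in>T. f (\<sigma> y - g))" .
      qed
      finally show False by (simp add: sum)
    qed
    define F where "F y = f (\<sigma> y - g)" for y
    define c where "c = box_mean B N F"
    have F: "periodic (period_lattice B N) F" using per by (simp add: F_def[abs_def])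
    have c: "1 / real m \<le> c" using g by (simp add: c_def F_def[abs_def])
    \<comment> \<open>Moving along the axis of \<open>b\<close> changes only one summand of
      \<open>\<sigma>\<close>, by a multiple of \<open>b\<close>, which lies in
      \<open>W\<close>.\<close>
    have lip: "\<bar>F (y + int_scale (int k) (axis_vec b)) - F y\<bar> \<le> 1 / real n" if "b \<in> B" for b y k
    proof -
      define w where "w = int_scale ((y b + int k) mod int N - y b mod int N) b"
      have "\<sigma> (y + int_scale (int k) (axis_vec b)) - \<sigma> y = (\<Sum>a\<in>B. if a = b then w else 0)"
        unfolding \<sigma>_def by (simp only: flip: sum_subtractf)
          (intro sum.cong, auto simp: int_scale_axis_vec w_def int_scale_diff)
      also have "\<dots> = w" using B that by simp
      finally have "\<sigma> (y + int_scale (int k) (axis_vec b)) = \<sigma> y + w" by (simp add: algebra_simps)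
      then have "F (y + int_scale (int k) (axis_vec b)) = f (\<sigma> y - g + w)"
        by (simp add: F_def algebra_simps)
      moreover have "w \<in> W" unfolding w_def by (rule small[OF that])
      ultimately show ?thesis using f_lip by (simp add: F_def)
    qed
    have corr_nonzero: "\<exists>y. F y \<noteq> 0 \<and> F (y + x) \<noteq> 0" if "corr F F x \<noteq> 0" for x
    proof (rule ccontr)
      assume "\<not> (\<exists>y. F y \<noteq> 0 \<and> F (y + x) \<noteq> 0)"
      then have "(\<lambda>y. F y * F (y + x)) = (\<lambda>_. 0)" by auto
      then show False using that by (simp add: corr_def const)
    qed
    have F_support: "\<exists>v\<in>V. \<exists>v'\<in>V. \<sigma> y = g + v + v'" if "F y \<noteq> 0" for y
      using f_V(2)[of "\<sigma> y - g"] that by (auto simp: F_def algebra_simps)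
    \<comment> \<open>Otherwise four support points express the combination with coefficients
      \<open>z\<close> by eight elements of \<open>V\<close> and the additivity defect, forcing it
      into \<open>U\<close>.\<close>
    have "corr F F x = 0 \<or> corr F F (x + z) = 0" for x
    proof (rule ccontr)
      assume "\<not> ?thesis"
      then obtain y y' where "F y \<noteq> 0" "F (y + x) \<noteq> 0" "F y' \<noteq> 0" "F (y' + (x + z)) \<noteq> 0"
        using corr_nonzero by blast
      note F_support[OF this(1)] F_support[OF this(2)] F_support[OF this(3)] F_support[OF this(4)]
      then obtain v1 v2 v3 v4 v5 v6 v7 v8 where
        v: "v1 \<in> V" "v2 \<in> V" "v3 \<in> V" "v4 \<in> V" "v5 \<in> V" "v6 \<in> V" "v7 \<in> V" "v8 \<in> V" and
        \<sigma>: "\<sigma> y = g + v1 + v2" "\<sigma> (y + x) = g + v3 + v4" "\<sigma> y' = g + v5 + v6"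
          "\<sigma> (y' + (x + z)) = g + v7 + v8"
        by (elim bexE)
      \<comment> \<open>Modulo \<open>N\<close> this is \<open>z - (x + z) + x = 0\<close>.\<close>
      define d where "d b = z b - ((y' + (x + z)) b mod int N - y' b mod int N)
        + ((y + x) b mod int N - y b mod int N)" for b
      have "(\<Sum>b\<in>B. int_scale (d b) b) \<in> V"
      proof (rule error)
        fix b
        assume b: "b \<in> B"
        have "d b = int N * ((y' b + (x b + z b)) div int N - y' b div int N
            - (y b + x b) div int N + y b div int N)"
          unfolding d_def plus_fun_apply
          by (simp only: minus_mult_div_eq_mod[symmetric]) (simp add: algebra_simps)
        then show "int N dvd d b" by simp
        have mod_N: "0 \<le> q mod int N \<and> q mod int N < int N" for q using N(1) by simp
        then have "\<bar>d b\<bar> \<le> \<bar>z b\<bar> + 2 * int N"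
          using mod_N[of "(y' + (x + z)) b"] mod_N[of "y' b"] mod_N[of "(y + x) b"] mod_N[of "y b"]
          unfolding d_def by linarith
        also have "\<dots> \<le> int N * \<bar>z b\<bar> + 2 * int N" using N(1) by (simp add: mult_le_cancel_right1)
        also have "\<dots> = int N * (2 + \<bar>z b\<bar>)" by (simp add: algebra_simps)
        also have "\<dots> \<le> int N * int K"
          using member_le_sum[OF b, of "\<lambda>b. nat \<bar>z b\<bar>"] B
          by (intro mult_left_mono) (auto simp: K_def simp del: of_nat_sum)
        finally show "\<bar>d b\<bar> \<le> int N * int K" .
      qed
      moreover have "(\<Sum>b\<in>B. int_scale (z b) b) =
          (\<Sum>b\<in>B. int_scale (d b) b) + (\<sigma> (y' + (x + z)) - \<sigma> y') - (\<sigma> (y + x) - \<sigma> y)"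
        unfolding \<sigma>_def d_def
        by (simp add: int_scale_add int_scale_diff sum.distrib sum_subtractf)
      moreover have "\<dots> = (\<Sum>b\<in>B. int_scale (d b) b) + v7 + v8 + - v5 + - v6 + - v3 + - v4 + v1 + v2"
        unfolding \<sigma> by (simp add: algebra_simps)
      ultimately have "(\<Sum>b\<in>B. int_scale (z b) b) \<in> U"
        by (simp only:) (intro sum9 v V(3))
      with notin show False by simp
    qed
    then have lower: "2 * (box_mean B N (corr F F))\<^sup>2 \<le> energy F"
      by (rule energy_lower_bound[OF F])
    have axis: "int_scale (int N) (axis_vec b) \<in> period_lattice B N" for b
      by (simp add: period_lattice_def int_scale_axis_vec)
    have ergodic: "H y = H 0"
      if "periodic (period_lattice B N) H" "\<And>b y. b \<in> B \<Longrightarrow> H (y + axis_vec b) = H y" for H y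
      using B N(1) that by (rule axis_invariant_imp_constant)
    have upper: "energy F \<le> c ^ 4 + (1 / real n)\<^sup>2 * box_mean B N (\<lambda>y. (F y)\<^sup>2)"
      unfolding c_def using B N(1) axis F lip ergodic by (rule energy_bound(1))
    have "box_mean B N (corr F F) = c\<^sup>2"
      unfolding c_def using B N(1) axis F lip ergodic by (rule energy_bound(2))
    with lower have lower': "2 * (c\<^sup>2)\<^sup>2 \<le> energy F" by simp
    have "box_mean B N (\<lambda>y. (F y)\<^sup>2) \<le> 1"
      using mono[of "\<lambda>y. (F y)\<^sup>2" "\<lambda>_. 1"] f_bounds by (simp add: F_def const power_le_one)
    then have "(1 / real n)\<^sup>2 * box_mean B N (\<lambda>y. (F y)\<^sup>2) \<le> (1 / real n)\<^sup>2"
      by (intro mult_left_le) auto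
    moreover have "c ^ 4 = (c\<^sup>2)\<^sup>2" by simp
    ultimately have "(c\<^sup>2)\<^sup>2 \<le> (1 / real n)\<^sup>2"
      using upper lower' by linarith
    then have "c\<^sup>2 \<le> 1 / real n" by (rule power2_le_imp_le) simp
    also have "\<dots> < 1 / real (m\<^sup>2)"
      using \<open>m > 0\<close> by (intro divide_strict_left_mono mult_pos_pos) (auto simp: n_def add_pos_nonneg)
    also have "\<dots> = (1 / real m)\<^sup>2" by (simp add: power_divide)
    also have "\<dots> \<le> c\<^sup>2" using c by (intro power_mono) auto
    finally show False by simp
  qed
  with W show ?thesis using that by blast
qed

section \<open>From topological independence to small cyclic subgroups\<close>

text \<open>Otherwise a block of consecutive terms \<open>k i a i\<close>, all outside
  \<open>W\<close>, would sum to an element of \<open>U\<close>, and independence would put its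
  first term into \<open>W\<close>.\<close>

lemma topologically_independent_cofinite_small:
  fixes A :: "'g::{topological_ab_group_add, t2_space} set"
  assumes "precompact_group TYPE('g) TYPE('k::{topological_ab_group_add, t2_space})"
    and "topologically_independent A" "open W" "0 \<in> W"
  shows "finite {a \<in> A. \<exists>k. int_scale k a \<notin> W}"
proof (rule ccontr)
  assume "infinite {a \<in> A. \<exists>k. int_scale k a \<notin> W}"
  then obtain a :: "nat \<Rightarrow> 'g" where a: "inj a" "range a \<subseteq> {a \<in> A. \<exists>k. int_scale k a \<notin> W}"
    by (meson infinite_countable_subset)
  then have "\<forall>i. \<exists>k. int_scale k (a i) \<notin> W" by blast
  then obtain k where k: "\<And>i. int_scale (k i) (a i) \<notin> W" by metis
  have "0 \<in> interior W" using assms(3,4) by (simp add: interior_open)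
  then obtain U where U: "0 \<in> interior U" "\<And>B z. finite B \<Longrightarrow> B \<subseteq> A \<Longrightarrow>
      (\<Sum>a\<in>B. int_scale (z a) a) \<in> U \<Longrightarrow> (\<forall>a\<in>B. int_scale (z a) a \<in> W)"
    using assms(2) unfolding topologically_independent_def by meson
  define s where "s j = (\<Sum>i<j. int_scale (k i) (a i))" for j
  obtain i j where ij: "i < j" "s j - s i \<in> interior U"
    using precompact_pigeonhole[OF assms(1) open_interior U(1), of "{()}" "\<lambda>j _. s j"] by auto
  have "s j - s i = (\<Sum>l\<in>{i..<j}. int_scale (k l) (a l))"
    unfolding s_def using ij(1) by (simp add: lessThan_atLeast0 sum_diff_nat_ivl)
  \<comment> \<open>Independence indexes coefficients by group elements; injectivity of
    \<open>a\<close> allows passing to them through \<open>inv a\<close>.\<close>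
  also have "\<dots> = (\<Sum>b\<in>a ` {i..<j}. int_scale (k (inv a b)) b)"
    using a(1) by (subst sum.reindex) (auto intro: inj_on_subset)
  finally have "(\<Sum>b\<in>a ` {i..<j}. int_scale (k (inv a b)) b) \<in> U"
    using ij(2) interior_subset by auto
  then have "\<forall>b\<in>a ` {i..<j}. int_scale (k (inv a b)) b \<in> W"
    by (rule U(2)[rotated 2]) (use a(2) in auto)
  then have "int_scale (k i) (a i) \<in> W" using ij(1) a(1) by auto
  with k show False by blast
qed

theorem proposition2p7:
  fixes A :: "'g::{topological_ab_group_add, t2_space} set"
  assumes "precompact_group TYPE('g) TYPE('k::{topological_ab_group_add, t2_space})"
    and "topologically_independent A"
  shows "absolutely_cauchy_summable A"
  unfolding absolutely_cauchy_summable_def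
proof (intro allI impI)
  fix U :: "'g set"
  assume "0 \<in> interior U"
  then obtain W where W: "open W" "0 \<in> W" "\<And>B z. finite B \<Longrightarrow>
      (\<And>b k. b \<in> B \<Longrightarrow> int_scale k b \<in> W) \<Longrightarrow> (\<Sum>b\<in>B. int_scale (z b) b) \<in> interior U"
    using precompact_small_cyclic_sums[OF assms(1) open_interior] by blast
  \<comment> \<open>Elements of \<open>A\<close> outside this finite set generate cyclic subgroups
    inside \<open>W\<close>.\<close>
  define F where "F = {a \<in> A. \<exists>k. int_scale k a \<notin> W}"
  have "finite F" "F \<subseteq> A"
    using topologically_independent_cofinite_small[OF assms W(1,2)] by (auto simp: F_def)
  moreover have "group_closure (A - F) \<subseteq> U"
  proof
    fix x
    assume "x \<in> group_closure (A - F)"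
    then obtain B z where "finite B" "B \<subseteq> A - F" "x = (\<Sum>b\<in>B. int_scale (z b) b)"
      by (rule group_closure_int_combination)
    with W(3)[of B z] have "x \<in> interior U" by (auto simp: F_def)
    then show "x \<in> U" using interior_subset by blast
  qed
  ultimately show "\<exists>F. finite F \<and> F \<subseteq> A \<and> group_closure (A - F) \<subseteq> U" by blast
qed

end
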